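(* Let $\mathcal H^{mp}$ be the Hopf algebra of matroid perspectives, and let $\alpha(\mathbf a,\mathbf b)=\exp_*(\delta_{\mathbf a})*\exp_*(\delta_{\mathbf b})$ with $\delta_{\mathbf a}=x_1\delta_{cc}+x_2\delta_{ll}+x_3\delta_{cl}$ and $\delta_{\mathbf b}=y_1\delta_{cc}+y_2\delta_{ll}+y_3\delta_{cl}$. Then for every matroid perspective $\mathbf M=M\to M'$ with ground set $E$, where $r$ is the rank function of $M$ and $r'$ that of $M'$, $$\alpha(\mathbf a,\mathbf b)(\mathbf M)=x_1^{r'(E)}\,y_2^{|E|-r(E)}\,x_3^{r(E)-r'(E)}\,T_{\mathbf M}\Big(\frac{y_1}{x_1}+1,\frac{x_2}{y_2}+1,\frac{y_3}{x_3}\Big).$$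
   Context: A matroid perspective $M\to M'$ is a pair of matroids $M=(E,r)$, $M'=(E,r')$ on the same ground set with $r(B)-r(A)\ge r'(B)-r'(A)$ for all $A\subseteq B\subseteq E$; considered up to isomorphism. Deletion and contraction are componentwise: $(M\to M')\backslash A=M\backslash A\to M'\backslash A$, $(M\to M')/A=M/A\to M'/A$; direct sum is componentwise. $\mathcal H^{mp}$ is the free module (over a field of characteristic 0) spanned by isomorphism classes of matroid perspectives, graded by $|E|$, with multiplication direct sum, counit $1$ on the empty perspective and $0$ otherwise, and coproduct $\Delta(\mathbf M)=\sum_{A\subseteq E}\mathbf M\backslash A^c\otimes\mathbf M/A$. $\delta_{cc},\delta_{ll},\delta_{cl}$ are the linear maps equal to $1$ respectively on $U_{1,1}\to U_{1,1}$, on $U_{0,1}\to U_{0,1}$, on $U_{1,1}\to U_{0,1}$, and $0$ on all other perspectives. $f*g=m\circ(f\otimes g)\circ\Delta$, $\exp_*(\delta)=\sum_{k\ge0}\delta^{*k}/k!$ with $\delta^{*0}=\varepsilon$. Las Vergnas' Tutte polynomial: $T_{\mathbf M}(x,y,z)=\sum_{A\subseteq E}(x-1)^{r'(E)-r'(A)}(y-1)^{|A|-r(A)}z^{(r(E)-r(A))-(r'(E)-r'(A))}$. *)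

theory Defs
  imports "HOL-Library.Poly_Mapping"
begin

section \<open>Matroids and matroid perspectives\<close>

text \<open>A rank function is defined on all sets of the element type; the second clause makes
  it depend only on the part inside the ground set, so that equality of pairs
  is equality of matroids.\<close>

definition is_rank_function :: "'a set \<Rightarrow> ('a set \<Rightarrow> nat) \<Rightarrow> bool" where
  "is_rank_function E r \<longleftrightarrow>
     finite E \<and>
     (\<forall>X. r X = r (X \<inter> E)) \<and>
     (\<forall>X\<subseteq>E. r X \<le> card X) \<and>
     (\<forall>X Y. X \<subseteq> Y \<and> Y \<subseteq> E \<longrightarrow> r X \<le> r Y) \<and>
     (\<forall>X Y. X \<subseteq> E \<and> Y \<subseteq> E \<longrightarrow> r (X \<union> Y) + r (X \<inter> Y) \<le> r X + r Y)"

lemma is_rank_functionI: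
  assumes "finite E" "\<And>X. r X = r (X \<inter> E)" "\<And>X. X \<subseteq> E \<Longrightarrow> r X \<le> card X"
    "\<And>X Y. X \<subseteq> Y \<Longrightarrow> r X \<le> r Y" "\<And>X Y. r (X \<union> Y) + r (X \<inter> Y) \<le> r X + r Y"
  shows "is_rank_function E r"
  unfolding is_rank_function_def
  by (intro conjI allI impI; (elim conjE)?) (fact assms | (rule assms, assumption) | rule assms)+

lemma is_rank_functionD:
  assumes "is_rank_function E r"
  shows "finite E" "r X = r (X \<inter> E)" "X \<subseteq> E \<Longrightarrow> r X \<le> card X"
    "X \<subseteq> Y \<Longrightarrow> r X \<le> r Y" "r (X \<union> Y) + r (X \<inter> Y) \<le> r X + r Y"
proof -
  have fin: "finite E" and n: "\<forall>X. r X = r (X \<inter> E)" and c: "\<forall>X\<subseteq>E. r X \<le> card X"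
    and m: "\<forall>X Y. X \<subseteq> Y \<and> Y \<subseteq> E \<longrightarrow> r X \<le> r Y"
    and s: "\<forall>X Y. X \<subseteq> E \<and> Y \<subseteq> E \<longrightarrow> r (X \<union> Y) + r (X \<inter> Y) \<le> r X + r Y"
    using assms unfolding is_rank_function_def by - (elim conjE, assumption)+
  show "finite E" by (rule fin)
  show "r X = r (X \<inter> E)" by (rule n[rule_format])
  show "X \<subseteq> E \<Longrightarrow> r X \<le> card X" by (rule c[rule_format])
  show "r X \<le> r Y" if "X \<subseteq> Y"
  proof -
    have "r (X \<inter> E) \<le> r (Y \<inter> E)" by (rule m[rule_format]) (use that in auto)
    then show ?thesis by (simp only: n[rule_format, of X] n[rule_format, of Y])
  qed
  have "r ((X \<inter> E) \<union> (Y \<inter> E)) + r ((X \<inter> E) \<inter> (Y \<inter> E)) \<le> r (X \<inter> E) + r (Y \<inter> E)"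
    by (rule s[rule_format]) auto
  moreover have "(X \<inter> E) \<union> (Y \<inter> E) = (X \<union> Y) \<inter> E" "(X \<inter> E) \<inter> (Y \<inter> E) = (X \<inter> Y) \<inter> E" by auto
  ultimately show "r (X \<union> Y) + r (X \<inter> Y) \<le> r X + r Y"
    using n[rule_format, of X] n[rule_format, of Y] n[rule_format, of "X \<union> Y"]
      n[rule_format, of "X \<inter> Y"] by (metis (no_types))
qed

typedef 'a matroid = "{(E :: 'a set, r). is_rank_function E r}"
  by (rule exI[of _ "({}, \<lambda>_. 0)"]) (simp add: is_rank_function_def)

setup_lifting type_definition_matroid

lift_definition mground :: "'a matroid \<Rightarrow> 'a set" is fst .
lift_definition mrank :: "'a matroid \<Rightarrow> 'a set \<Rightarrow> nat" is snd .

lemma is_rank_function_mrank: "is_rank_function (mground M) (mrank M)"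
  by transfer auto

lemmas mrank_simps = is_rank_functionD[OF is_rank_function_mrank]

lift_definition mdelete :: "'a matroid \<Rightarrow> 'a set \<Rightarrow> 'a matroid" is
  "\<lambda>(E, r) A. (E - A, \<lambda>X. r (X - A))"
proof (clarsimp, rule is_rank_functionI)
  fix E :: "'a set" and r A X Y
  assume r: "is_rank_function E r"
  note R = is_rank_functionD[OF r]
  show "finite (E - A)" using R by simp
  have "(X - A) \<inter> E = (X \<inter> (E - A) - A) \<inter> E" by auto
  then show "r (X - A) = r (X \<inter> (E - A) - A)"
    using R(2)[of "X - A"] R(2)[of "X \<inter> (E - A) - A"] by presburger
  show "r (X - A) \<le> card X" if "X \<subseteq> E - A"
  proof -
    have "X - A = X" "X \<subseteq> E" using that by auto
    then show ?thesis using R(3)[of X] by simp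
  qed
  show "r (X - A) \<le> r (Y - A)" if "X \<subseteq> Y" by (rule R(4)) (use that in auto)
  have "X \<union> Y - A = (X - A) \<union> (Y - A)" "X \<inter> Y - A = (X - A) \<inter> (Y - A)" by auto
  then show "r (X \<union> Y - A) + r (X \<inter> Y - A) \<le> r (X - A) + r (Y - A)"
    using R(5)[of "X - A" "Y - A"] by presburger
qed

lift_definition mcontract :: "'a matroid \<Rightarrow> 'a set \<Rightarrow> 'a matroid" is
  "\<lambda>(E, r) A. (E - A, \<lambda>X. r (X \<union> A) - r A)"
proof (clarsimp, rule is_rank_functionI)
  fix E :: "'a set" and r A X Y
  assume r: "is_rank_function E r"
  note R = is_rank_functionD[OF r]
  show "finite (E - A)" using R by simp
  have "(X \<union> A) \<inter> E = (X \<inter> (E - A) \<union> A) \<inter> E" by auto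
  then show "r (X \<union> A) - r A = r (X \<inter> (E - A) \<union> A) - r A"
    using R(2)[of "X \<union> A"] R(2)[of "X \<inter> (E - A) \<union> A"] by presburger
  show "r (X \<union> A) - r A \<le> card X" if "X \<subseteq> E - A"
  proof -
    have "r (X \<union> A) \<le> r X + r A" using R(5)[of X A] by simp
    moreover have "r X \<le> card X" using R(3)[of X] that by auto
    ultimately show ?thesis by simp
  qed
  show "r (X \<union> A) - r A \<le> r (Y \<union> A) - r A" if "X \<subseteq> Y"
    by (rule diff_le_mono, rule R(4)) (use that in auto)
  have "r A \<le> r (Z \<union> A)" for Z by (rule R(4)) auto
  note this[of X] this[of Y] this[of "X \<inter> Y"] this[of "X \<union> Y"]
  moreover have "X \<union> Y \<union> A = (X \<union> A) \<union> (Y \<union> A)" "X \<inter> Y \<union> A = (X \<union> A) \<inter> (Y \<union> A)" by auto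
  then have "r (X \<union> Y \<union> A) + r (X \<inter> Y \<union> A) \<le> r (X \<union> A) + r (Y \<union> A)"
    using R(5)[of "X \<union> A" "Y \<union> A"] by presburger
  ultimately show "r (X \<union> Y \<union> A) - r A + (r (X \<inter> Y \<union> A) - r A)
      \<le> r (X \<union> A) - r A + (r (Y \<union> A) - r A)"
    by linarith
qed

lift_definition msum :: "'a matroid \<Rightarrow> 'b matroid \<Rightarrow> ('a + 'b) matroid" is
  "\<lambda>(E, r) (F, s). (E <+> F, \<lambda>X. r (Inl -` X) + s (Inr -` X))"
proof (clarsimp, rule is_rank_functionI)
  fix E :: "'a set" and F :: "'b set" and r s X Y
  assume r: "is_rank_function E r" and s: "is_rank_function F s"
  note R = is_rank_functionD[OF r] and S = is_rank_functionD[OF s]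
  show "finite (E <+> F)" using R S by simp
  have "Inl -` (X \<inter> (E <+> F)) = Inl -` X \<inter> E" "Inr -` (X \<inter> (E <+> F)) = Inr -` X \<inter> F" by auto
  then show "r (Inl -` X) + s (Inr -` X) = r (Inl -` (X \<inter> (E <+> F))) + s (Inr -` (X \<inter> (E <+> F)))"
    using R(2)[of "Inl -` X"] S(2)[of "Inr -` X"] by presburger
  show "r (Inl -` X) + s (Inr -` X) \<le> card X" if "X \<subseteq> E <+> F"
  proof -
    have sub: "Inl -` X \<subseteq> E" "Inr -` X \<subseteq> F" using that by auto
    have "X = Inl -` X <+> Inr -` X" using that by auto
    then have "card X = card (Inl -` X) + card (Inr -` X)"
      using card_Plus[of "Inl -` X" "Inr -` X"] sub R(1) S(1) by (metis finite_subset)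
    then show ?thesis using R(3)[OF sub(1)] S(3)[OF sub(2)] by simp
  qed
  show "r (Inl -` X) + s (Inr -` X) \<le> r (Inl -` Y) + s (Inr -` Y)" if "X \<subseteq> Y"
    by (intro add_mono R(4) S(4) vimage_mono that)
  show "r (Inl -` (X \<union> Y)) + s (Inr -` (X \<union> Y)) + (r (Inl -` (X \<inter> Y)) + s (Inr -` (X \<inter> Y)))
      \<le> r (Inl -` X) + s (Inr -` X) + (r (Inl -` Y) + s (Inr -` Y))"
    using R(5)[of "Inl -` X" "Inl -` Y"] S(5)[of "Inr -` X" "Inr -` Y"] by simp
qed

text \<open>The uniform matroid $U_{k,n}$ on the ground set \<open>{..<n}\<close>.\<close>

lift_definition uniform :: "nat \<Rightarrow> nat \<Rightarrow> nat matroid" is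
  "\<lambda>k n. ({..<n}, \<lambda>X. min k (card (X \<inter> {..<n})))"
proof (clarsimp, rule is_rank_functionI)
  fix k n :: nat and X Y :: "nat set"
  let ?c = "\<lambda>X. card (X \<inter> {..<n})"
  show "min k (?c X) \<le> card X" if "X \<subseteq> {..<n}" using that by (simp add: Int_absorb2)
  show "min k (?c X) \<le> min k (?c Y)" if "X \<subseteq> Y"
  proof -
    have "?c X \<le> ?c Y" using that by (intro card_mono) auto
    then show ?thesis by linarith
  qed
  have "(X \<union> Y) \<inter> {..<n} = (X \<inter> {..<n}) \<union> (Y \<inter> {..<n})"
    "(X \<inter> Y) \<inter> {..<n} = (X \<inter> {..<n}) \<inter> (Y \<inter> {..<n})" by auto
  then have "?c (X \<union> Y) + ?c (X \<inter> Y) = ?c X + ?c Y"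
    using card_Un_Int[of "X \<inter> {..<n}" "Y \<inter> {..<n}"] by simp
  moreover have "?c (X \<inter> Y) \<le> ?c X" "?c (X \<inter> Y) \<le> ?c Y" by (auto intro!: card_mono)
  ultimately show "min k (?c (X \<union> Y)) + min k (?c (X \<inter> Y)) \<le> min k (?c X) + min k (?c Y)"
    by linarith
qed simp_all

lemma mground_delete [simp]: "mground (mdelete M A) = mground M - A" by transfer auto
lemma mground_contract [simp]: "mground (mcontract M A) = mground M - A" by transfer auto
lemma mground_msum [simp]: "mground (msum M N) = mground M <+> mground N" by transfer auto
lemma mground_uniform [simp]: "mground (uniform k n) = {..<n}" by transfer auto
lemma mrank_delete [simp]: "mrank (mdelete M A) X = mrank M (X - A)" by transfer auto
lemma mrank_contract [simp]: "mrank (mcontract M A) X = mrank M (X \<union> A) - mrank M A" by transfer auto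
lemma mrank_msum [simp]: "mrank (msum M N) X = mrank M (Inl -` X) + mrank N (Inr -` X)" by transfer auto
lemma mrank_uniform [simp]: "mrank (uniform k n) X = min k (card (X \<inter> {..<n}))" by transfer auto

lifting_forget matroid.lifting

text \<open>Ranks are natural numbers, but the differences below are never truncated, because
  ranks are monotone.\<close>

definition is_perspective :: "'a matroid \<Rightarrow> 'a matroid \<Rightarrow> bool" where
  "is_perspective M M' \<longleftrightarrow>
     mground M = mground M' \<and>
     (\<forall>A B. A \<subseteq> B \<and> B \<subseteq> mground M \<longrightarrow> mrank M B - mrank M A \<ge> mrank M' B - mrank M' A)"

lemma is_perspectiveD:
  assumes "is_perspective M M'" "A \<subseteq> B"
  shows "mrank M B - mrank M A \<ge> mrank M' B - mrank M' A"
proof -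
  have g: "mground M' = mground M" using assms unfolding is_perspective_def by simp
  have "mrank M' (B \<inter> mground M) - mrank M' (A \<inter> mground M)
      \<le> mrank M (B \<inter> mground M) - mrank M (A \<inter> mground M)"
    using assms(2) by (intro conjunct2[OF assms(1)[unfolded is_perspective_def], rule_format]) auto
  then show ?thesis
    using mrank_simps(2)[of M A] mrank_simps(2)[of M B] mrank_simps(2)[of M' A]
      mrank_simps(2)[of M' B] unfolding g by presburger
qed

typedef 'a perspective = "{(M :: 'a matroid, M'). is_perspective M M'}"
  by (rule exI[of _ "(M, M)" for M]) (simp add: is_perspective_def)

setup_lifting type_definition_perspective

lift_definition upper :: "'a perspective \<Rightarrow> 'a matroid" is fst .
lift_definition lower :: "'a perspective \<Rightarrow> 'a matroid" is snd .

lemma is_perspective_upper_lower: "is_perspective (upper P) (lower P)"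
  by transfer auto

definition ground :: "'a perspective \<Rightarrow> 'a set" where
  "ground P = mground (upper P)"

lift_definition delete :: "'a perspective \<Rightarrow> 'a set \<Rightarrow> 'a perspective" is
  "\<lambda>(M, M') A. (mdelete M A, mdelete M' A)"
proof clarsimp
  fix M M' :: "'a matroid" and A :: "'a set"
  assume p: "is_perspective M M'"
  show "is_perspective (mdelete M A) (mdelete M' A)"
    using is_perspectiveD[OF p] p unfolding is_perspective_def by (simp add: Diff_mono)
qed

lift_definition contract :: "'a perspective \<Rightarrow> 'a set \<Rightarrow> 'a perspective" is
  "\<lambda>(M, M') A. (mcontract M A, mcontract M' A)"
proof clarsimp
  fix M M' :: "'a matroid" and A :: "'a set"
  assume p: "is_perspective M M'"
  have d: "mrank M (B \<union> A) - mrank M (C \<union> A) \<ge> mrank M' (B \<union> A) - mrank M' (C \<union> A)"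
    if "C \<subseteq> B" for B C
    by (rule is_perspectiveD[OF p]) (use that in auto)
  have m: "mrank N A \<le> mrank N (Z \<union> A)" for N :: "'a matroid" and Z by (rule mrank_simps(4)) auto
  show "is_perspective (mcontract M A) (mcontract M' A)"
    unfolding is_perspective_def mground_contract mrank_contract
  proof (intro conjI allI impI)
    show "mground M - A = mground M' - A" using p unfolding is_perspective_def by simp
    fix C B assume "C \<subseteq> B \<and> B \<subseteq> mground M - A"
    then show "mrank M' (B \<union> A) - mrank M' A - (mrank M' (C \<union> A) - mrank M' A)
        \<le> mrank M (B \<union> A) - mrank M A - (mrank M (C \<union> A) - mrank M A)"
      using d[of C B] m by simp
  qed
qed

lift_definition perspective_sum ::
    "'a perspective \<Rightarrow> 'b perspective \<Rightarrow> ('a + 'b) perspective" is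
  "\<lambda>(M, M') (N, N'). (msum M N, msum M' N')"
proof clarsimp
  fix M M' :: "'a matroid" and N N' :: "'b matroid"
  assume p: "is_perspective M M'" and q: "is_perspective N N'"
  have "mrank M' (Inl -` B) + mrank N' (Inr -` B) - (mrank M' (Inl -` A) + mrank N' (Inr -` A))
     \<le> mrank M (Inl -` B) + mrank N (Inr -` B) - (mrank M (Inl -` A) + mrank N (Inr -` A))"
    if "A \<subseteq> B" for A B
  proof -
    have l: "Inl -` A \<subseteq> Inl -` B" "Inr -` A \<subseteq> Inr -` B" using that by auto
    show ?thesis
      using is_perspectiveD[OF p l(1)] is_perspectiveD[OF q l(2)]
        mrank_simps(4)[OF l(1), of M] mrank_simps(4)[OF l(1), of M']
        mrank_simps(4)[OF l(2), of N] mrank_simps(4)[OF l(2), of N'] by linarith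
  qed
  then show "is_perspective (msum M N) (msum M' N')"
    using p q unfolding is_perspective_def by simp
qed

lift_definition U11_U11 :: "nat perspective" is "(uniform 1 1, uniform 1 1)"
  by (simp add: is_perspective_def)
lift_definition U01_U01 :: "nat perspective" is "(uniform 0 1, uniform 0 1)"
  by (simp add: is_perspective_def)
lift_definition U11_U01 :: "nat perspective" is "(uniform 1 1, uniform 0 1)"
  by (simp add: is_perspective_def)
lift_definition empty_perspective :: "nat perspective" is "(uniform 0 0, uniform 0 0)"
  by (simp add: is_perspective_def)

lemma upper_simps [simp]: "upper (delete P A) = mdelete (upper P) A"
  "upper (contract P A) = mcontract (upper P) A" "upper (perspective_sum P Q) = msum (upper P) (upper Q)"
  by (transfer, auto)+
lemma lower_simps [simp]: "lower (delete P A) = mdelete (lower P) A"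
  "lower (contract P A) = mcontract (lower P) A" "lower (perspective_sum P Q) = msum (lower P) (lower Q)"
  by (transfer, auto)+


section \<open>Isomorphism classes\<close>

definition matroid_iso :: "('a \<Rightarrow> 'b) \<Rightarrow> 'a matroid \<Rightarrow> 'b matroid \<Rightarrow> bool" where
  "matroid_iso f M N \<longleftrightarrow>
     bij_betw f (mground M) (mground N) \<and> (\<forall>X\<subseteq>mground M. mrank N (f ` X) = mrank M X)"

definition isomorphic :: "'a perspective \<Rightarrow> 'b perspective \<Rightarrow> bool" where
  "isomorphic P Q \<longleftrightarrow>
     (\<exists>f. matroid_iso f (upper P) (upper Q) \<and> matroid_iso f (lower P) (lower Q))"

lemma lower_ground: "mground (lower P) = mground (upper P)"
  by (rule conjunct1[OF is_perspective_upper_lower[unfolded is_perspective_def], symmetric])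

lemma matroid_isoI:
  assumes "bij_betw f (mground M) (mground N)" "\<And>X. X \<subseteq> mground M \<Longrightarrow> mrank N (f ` X) = mrank M X"
  shows "matroid_iso f M N"
  unfolding matroid_iso_def by (intro conjI allI impI assms)

lemma matroid_isoD:
  assumes "matroid_iso f M N"
  shows "bij_betw f (mground M) (mground N)" "X \<subseteq> mground M \<Longrightarrow> mrank N (f ` X) = mrank M X"
  by (rule conjunct1[OF assms[unfolded matroid_iso_def]],
      rule conjunct2[OF assms[unfolded matroid_iso_def], rule_format])

lemma matroid_iso_id: "matroid_iso id M M"
  by (rule matroid_isoI) simp_all

lemma matroid_iso_comp:
  assumes f: "matroid_iso f M N" and g: "matroid_iso g N L" shows "matroid_iso (g \<circ> f) M L"
proof (rule matroid_isoI)
  show "bij_betw (g \<circ> f) (mground M) (mground L)"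
    by (rule bij_betw_trans[OF matroid_isoD(1)[OF f] matroid_isoD(1)[OF g]])
  fix X assume X: "X \<subseteq> mground M"
  then have fX: "f ` X \<subseteq> mground N" using matroid_isoD(1)[OF f] unfolding bij_betw_def by auto
  have "mrank L (g ` (f ` X)) = mrank N (f ` X)" by (rule matroid_isoD(2)[OF g fX])
  also have "\<dots> = mrank M X" by (rule matroid_isoD(2)[OF f X])
  finally show "mrank L ((g \<circ> f) ` X) = mrank M X" by (simp only: image_comp)
qed

lemma matroid_iso_inv:
  assumes f: "matroid_iso f M N" shows "matroid_iso (inv_into (mground M) f) N M"
proof (rule matroid_isoI)
  note b = matroid_isoD(1)[OF f]
  show b': "bij_betw (inv_into (mground M) f) (mground N) (mground M)"
    by (rule bij_betw_inv_into[OF b])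
  fix X assume X: "X \<subseteq> mground N"
  let ?Y = "inv_into (mground M) f ` X"
  have Y: "?Y \<subseteq> mground M" using b' X unfolding bij_betw_def by auto
  have "f ` ?Y = X" by (rule image_inv_into_cancel[OF bij_betw_imp_surj_on[OF b] X])
  then show "mrank M ?Y = mrank N X" using matroid_isoD(2)[OF f Y] by simp
qed

lemma isomorphic_refl: "isomorphic P P"
  unfolding isomorphic_def using matroid_iso_id by blast

lemma isomorphic_trans: "isomorphic P Q \<Longrightarrow> isomorphic Q R \<Longrightarrow> isomorphic P R"
  unfolding isomorphic_def by (blast intro: matroid_iso_comp)

lemma isomorphic_sym: "isomorphic P Q \<Longrightarrow> isomorphic Q P"
proof -
  assume "isomorphic P Q"
  then obtain f where f: "matroid_iso f (upper P) (upper Q)" "matroid_iso f (lower P) (lower Q)"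
    unfolding isomorphic_def by blast
  show ?thesis unfolding isomorphic_def
    using matroid_iso_inv[OF f(1)] matroid_iso_inv[OF f(2)] unfolding lower_ground by blast
qed

text \<open>Ground sets are finite, so the isomorphism classes of perspectives on subsets of
  \<open>nat\<close> represent the isomorphism classes of all perspectives.\<close>

quotient_type mp_class = "nat perspective" / "isomorphic :: nat perspective \<Rightarrow> nat perspective \<Rightarrow> bool"
  by (rule equivpI)
    (auto intro!: reflpI sympI transpI intro: isomorphic_refl isomorphic_sym isomorphic_trans)

lemma ex_matroid_iso:
  fixes M :: "'a matroid" and f :: "'a \<Rightarrow> nat"
  assumes inj: "inj_on f (mground M)"
  shows "\<exists>N. mground N = f ` mground M \<and> matroid_iso f M N
           \<and> (\<forall>X. mrank N X = mrank M (f -` X \<inter> mground M))"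
proof -
  let ?E = "mground M" and ?r = "\<lambda>X. mrank M (f -` X \<inter> mground M)"
  have rk: "is_rank_function (f ` ?E) ?r"
  proof (rule is_rank_functionI)
    fix X Y :: "nat set"
    show "finite (f ` ?E)" using mrank_simps(1) by blast
    have "f -` X \<inter> ?E = f -` (X \<inter> f ` ?E) \<inter> ?E" by auto
    then show "?r X = ?r (X \<inter> f ` ?E)" by simp
    show "?r X \<le> card X" if "X \<subseteq> f ` ?E"
    proof -
      have "f ` (f -` X \<inter> ?E) = X" using that by auto
      then have "card (f -` X \<inter> ?E) = card X"
        using card_image[of f "f -` X \<inter> ?E"] inj by (metis Int_lower2 inj_on_subset)
      then show ?thesis using mrank_simps(3)[of "f -` X \<inter> ?E" M] by simp
    qed
    show "?r X \<le> ?r Y" if "X \<subseteq> Y" by (rule mrank_simps(4)) (use that in auto)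
    have "f -` (X \<union> Y) \<inter> ?E = (f -` X \<inter> ?E) \<union> (f -` Y \<inter> ?E)"
      "f -` (X \<inter> Y) \<inter> ?E = (f -` X \<inter> ?E) \<inter> (f -` Y \<inter> ?E)" by auto
    then show "?r (X \<union> Y) + ?r (X \<inter> Y) \<le> ?r X + ?r Y"
      using mrank_simps(5)[of M "f -` X \<inter> ?E" "f -` Y \<inter> ?E"] by presburger
  qed
  define N where "N = Abs_matroid (f ` ?E, ?r)"
  have N: "mground N = f ` ?E" "mrank N = ?r"
    using rk unfolding N_def by (simp_all add: mground.rep_eq mrank.rep_eq Abs_matroid_inverse)
  have "f -` f ` X \<inter> ?E = X" if "X \<subseteq> ?E" for X using inj that by (auto dest: inj_onD)
  then have "matroid_iso f M N" using inj by (intro matroid_isoI) (simp_all add: N bij_betw_def)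
  then show ?thesis using N by (intro exI[of _ N]) simp
qed

lemma ex_isomorphic: "\<exists>Q :: nat perspective. isomorphic P Q"
proof -
  have fin: "finite (mground (upper P))" by (rule mrank_simps(1))
  then obtain f :: "'a \<Rightarrow> nat" where f: "inj_on f (mground (upper P))"
    using finite_imp_inj_to_nat_seg by metis
  then have f': "inj_on f (mground (lower P))" by (simp add: lower_ground)
  obtain M where M: "mground M = f ` mground (upper P)" "matroid_iso f (upper P) M"
    "\<And>X. mrank M X = mrank (upper P) (f -` X \<inter> mground (upper P))" using ex_matroid_iso[OF f] by metis
  obtain M' where M': "mground M' = f ` mground (lower P)" "matroid_iso f (lower P) M'"
    "\<And>X. mrank M' X = mrank (lower P) (f -` X \<inter> mground (lower P))" using ex_matroid_iso[OF f'] by metis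
  have "is_perspective M M'" unfolding is_perspective_def
  proof (intro conjI allI impI)
    show "mground M = mground M'" by (simp add: M(1) M'(1) lower_ground)
    fix A B assume "A \<subseteq> B \<and> B \<subseteq> mground M"
    then have "f -` A \<inter> mground (upper P) \<subseteq> f -` B \<inter> mground (upper P)" by auto
    then show "mrank M' B - mrank M' A \<le> mrank M B - mrank M A"
      unfolding M(3) M'(3) lower_ground by (rule is_perspectiveD[OF is_perspective_upper_lower])
  qed
  then have "isomorphic P (Abs_perspective (M, M'))"
    unfolding isomorphic_def using M(2) M'(2)
    by (intro exI[of _ f]) (simp add: upper.rep_eq lower.rep_eq Abs_perspective_inverse)
  then show ?thesis by blast
qed

definition iso_class :: "'a perspective \<Rightarrow> mp_class" where
  "iso_class P = abs_mp_class (SOME Q. isomorphic P Q)"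

lemma isomorphic_some: "isomorphic P (SOME Q :: nat perspective. isomorphic P Q)"
  by (rule someI_ex) (rule ex_isomorphic)

lemma iso_class_eq_iff: "iso_class P = iso_class Q \<longleftrightarrow> isomorphic P Q"
proof -
  let ?P = "SOME R :: nat perspective. isomorphic P R" and ?Q = "SOME R :: nat perspective. isomorphic Q R"
  have P: "isomorphic P ?P" and Q: "isomorphic Q ?Q" by (rule isomorphic_some)+
  have "iso_class P = iso_class Q \<longleftrightarrow> isomorphic ?P ?Q"
    unfolding iso_class_def mp_class.abs_eq_iff ..
  also have "\<dots> \<longleftrightarrow> isomorphic P Q"
  proof
    assume "isomorphic ?P ?Q"
    then show "isomorphic P Q"
      by (rule isomorphic_trans[OF isomorphic_trans[OF P] isomorphic_sym[OF Q]])
  next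
    assume "isomorphic P Q"
    then show "isomorphic ?P ?Q"
      by (rule isomorphic_trans[OF isomorphic_trans[OF isomorphic_sym[OF P]] Q])
  qed
  finally show ?thesis .
qed

lemma abs_mp_class_eq: "abs_mp_class P = iso_class P"
  unfolding iso_class_def mp_class.abs_eq_iff by (rule isomorphic_some)


section \<open>The Hopf algebra of matroid perspectives\<close>

text \<open>The free module on isomorphism classes consists of the finitely supported coefficient
  functions.  Its tensor square is the free module on pairs of classes.\<close>

type_synonym 'k hmp = "mp_class \<Rightarrow>\<^sub>0 'k"
type_synonym 'k hmp_tensor = "(mp_class \<times> mp_class) \<Rightarrow>\<^sub>0 'k"

abbreviation basis :: "'b \<Rightarrow> ('b \<Rightarrow>\<^sub>0 'k::zero_neq_one)" where
  "basis b \<equiv> Poly_Mapping.single b 1"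

definition scale :: "'k \<Rightarrow> ('b \<Rightarrow>\<^sub>0 'k) \<Rightarrow> ('b \<Rightarrow>\<^sub>0 'k::comm_ring_1)" where
  "scale c = Poly_Mapping.map ((*) c)"

text \<open>The linear maps into the ground ring and into another free module with prescribed
  values on the basis.\<close>

definition lin_form :: "('b \<Rightarrow> 'k) \<Rightarrow> ('b \<Rightarrow>\<^sub>0 'k) \<Rightarrow> 'k::comm_ring_1" where
  "lin_form \<phi> h = (\<Sum>b\<in>Poly_Mapping.keys h. Poly_Mapping.lookup h b * \<phi> b)"

definition lin_map :: "('b \<Rightarrow> ('c \<Rightarrow>\<^sub>0 'k)) \<Rightarrow> ('b \<Rightarrow>\<^sub>0 'k) \<Rightarrow> ('c \<Rightarrow>\<^sub>0 'k::comm_ring_1)" where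
  "lin_map \<phi> h = (\<Sum>b\<in>Poly_Mapping.keys h. scale (Poly_Mapping.lookup h b) (\<phi> b))"

lemma matroid_iso_delete:
  assumes "matroid_iso f M N" "A \<subseteq> mground M"
  shows "matroid_iso f (mdelete M (mground M - A)) (mdelete N (mground N - f ` A))"
proof -
  note b = bij_betw_imp_inj_on[OF matroid_isoD(1)[OF assms(1)]]
    bij_betw_imp_surj_on[OF matroid_isoD(1)[OF assms(1)]]
  note r = matroid_isoD(2)[OF assms(1)]
  have e: "mground M - (mground M - A) = A" "mground N - (mground N - f ` A) = f ` A"
    using assms(2) b(2) by auto
  have "mrank N (f ` X - (mground N - f ` A)) = mrank M (X - (mground M - A))" if "X \<subseteq> A" for X
  proof -
    have "f ` X - (mground N - f ` A) = f ` X" "X - (mground M - A) = X" using that by auto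
    then show ?thesis using r[of X] that assms(2) by simp
  qed
  then show ?thesis
    by (intro matroid_isoI)
      (simp_all add: e bij_betw_def inj_on_subset[OF b(1) assms(2)])
qed

lemma matroid_iso_contract:
  assumes "matroid_iso f M N" "A \<subseteq> mground M"
  shows "matroid_iso f (mcontract M A) (mcontract N (f ` A))"
proof -
  note b = bij_betw_imp_inj_on[OF matroid_isoD(1)[OF assms(1)]]
    bij_betw_imp_surj_on[OF matroid_isoD(1)[OF assms(1)]]
  note r = matroid_isoD(2)[OF assms(1)]
  have "f ` (mground M - A) = mground N - f ` A"
    using inj_on_image_set_diff[OF b(1) Diff_subset assms(2)] b(2) by simp
  moreover have "mrank N (f ` X \<union> f ` A) = mrank M (X \<union> A)" if "X \<subseteq> mground M - A" for X
  proof -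
    have "X \<union> A \<subseteq> mground M" using that assms(2) by auto
    from r[OF this] show ?thesis by (simp add: image_Un)
  qed
  ultimately show ?thesis
    by (intro matroid_isoI)
      (simp_all add: bij_betw_def r[OF assms(2)] inj_on_subset[OF b(1) Diff_subset])
qed

lemma matroid_iso_msum:
  assumes "matroid_iso f M N" "matroid_iso g M' N'"
  shows "matroid_iso (map_sum f g) (msum M M') (msum N N')"
proof -
  note f = bij_betw_imp_inj_on[OF matroid_isoD(1)[OF assms(1)]]
    bij_betw_imp_surj_on[OF matroid_isoD(1)[OF assms(1)]]
  note g = bij_betw_imp_inj_on[OF matroid_isoD(1)[OF assms(2)]]
    bij_betw_imp_surj_on[OF matroid_isoD(1)[OF assms(2)]]
  note rf = matroid_isoD(2)[OF assms(1)] and rg = matroid_isoD(2)[OF assms(2)]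
  have v: "Inl -` (map_sum f g ` X) = f ` (Inl -` X)" "Inr -` (map_sum f g ` X) = g ` (Inr -` X)" for X
  proof -
    have "Inl b \<in> map_sum f g ` X \<longleftrightarrow> b \<in> f ` (Inl -` X)" for b
    proof
      assume "Inl b \<in> map_sum f g ` X"
      then obtain s where "s \<in> X" "Inl b = map_sum f g s" by (rule imageE)
      then show "b \<in> f ` (Inl -` X)" by (cases s) simp_all
    next
      assume "b \<in> f ` (Inl -` X)"
      then obtain a where "b = f a" "Inl a \<in> X" by blast
      then show "Inl b \<in> map_sum f g ` X" using imageI[of "Inl a" X "map_sum f g"] by simp
    qed
    then show "Inl -` (map_sum f g ` X) = f ` (Inl -` X)" by (intro set_eqI) simp
    have "Inr b \<in> map_sum f g ` X \<longleftrightarrow> b \<in> g ` (Inr -` X)" for b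
    proof
      assume "Inr b \<in> map_sum f g ` X"
      then obtain s where "s \<in> X" "Inr b = map_sum f g s" by (rule imageE)
      then show "b \<in> g ` (Inr -` X)" by (cases s) simp_all
    next
      assume "b \<in> g ` (Inr -` X)"
      then obtain a where "b = g a" "Inr a \<in> X" by blast
      then show "Inr b \<in> map_sum f g ` X" using imageI[of "Inr a" X "map_sum f g"] by simp
    qed
    then show "Inr -` (map_sum f g ` X) = g ` (Inr -` X)" by (intro set_eqI) simp
  qed
  have "map_sum f g ` (A <+> B) = f ` A <+> g ` B" for A B
    unfolding Plus_def image_Un image_image map_sum.simps ..
  then have "map_sum f g ` (mground M <+> mground M') = mground N <+> mground N'"
    by (simp only: f(2) g(2))
  moreover have "inj_on (map_sum f g) (mground M <+> mground M')"
  proof (rule inj_onI)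
    fix s t
    assume "s \<in> mground M <+> mground M'" "t \<in> mground M <+> mground M'" "map_sum f g s = map_sum f g t"
    then show "s = t" by (cases s; cases t) (use f(1) g(1) in \<open>auto dest: inj_onD\<close>)
  qed
  ultimately show ?thesis
  proof (intro matroid_isoI)
    fix X assume "X \<subseteq> mground (msum M M')"
    then have "Inl -` X \<subseteq> mground M" "Inr -` X \<subseteq> mground M'" by auto
    then show "mrank (msum N N') (map_sum f g ` X) = mrank (msum M M') X"
      unfolding mrank_msum v by (simp only: rf rg)
  qed (simp add: bij_betw_def)
qed

lemma isomorphic_rep: "isomorphic P (rep_mp_class (iso_class P))"
proof -
  have "iso_class P = iso_class (rep_mp_class (iso_class P))"
    unfolding abs_mp_class_eq[symmetric] by (metis Quotient_mp_class Quotient_abs_rep)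
  then show ?thesis by (simp only: iso_class_eq_iff)
qed

definition class_sum :: "mp_class \<Rightarrow> mp_class \<Rightarrow> mp_class" where
  "class_sum C D = iso_class (perspective_sum (rep_mp_class C) (rep_mp_class D))"

lemma class_sum_iso_class:
  "class_sum (iso_class P) (iso_class Q) = iso_class (perspective_sum P Q)"
proof -
  have "isomorphic P (rep_mp_class (iso_class P))" "isomorphic Q (rep_mp_class (iso_class Q))"
    by (rule isomorphic_rep)+
  then have "isomorphic (perspective_sum P Q)
      (perspective_sum (rep_mp_class (iso_class P)) (rep_mp_class (iso_class Q)))"
    unfolding isomorphic_def upper_simps lower_simps using matroid_iso_msum by meson
  then show ?thesis unfolding class_sum_def iso_class_eq_iff by (rule isomorphic_sym)
qed

definition hmp_mult :: "'k::comm_ring_1 hmp \<Rightarrow> 'k hmp \<Rightarrow> 'k hmp" where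
  "hmp_mult g h = lin_map (\<lambda>C. lin_map (\<lambda>D. basis (class_sum C D)) h) g"

definition hmp_unit :: "'k::comm_ring_1 hmp" where
  "hmp_unit = basis (iso_class empty_perspective)"

definition perspective_coproduct :: "'a perspective \<Rightarrow> 'k::comm_ring_1 hmp_tensor" where
  "perspective_coproduct P =
     (\<Sum>A\<in>Pow (ground P). basis (iso_class (delete P (ground P - A)), iso_class (contract P A)))"

lemma perspective_coproduct_cong:
  assumes "isomorphic P Q"
  shows "perspective_coproduct P = (perspective_coproduct Q :: 'k::comm_ring_1 hmp_tensor)"
proof -
  obtain f where f: "matroid_iso f (upper P) (upper Q)" "matroid_iso f (lower P) (lower Q)"
    using assms unfolding isomorphic_def by blast
  then have "bij_betw f (ground P) (ground Q)" unfolding matroid_iso_def ground_def by blast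
  then have b: "bij_betw ((`) f) (Pow (ground P)) (Pow (ground Q))" by (rule bij_betw_Pow)
  have "iso_class (delete P (ground P - A)) = iso_class (delete Q (ground Q - f ` A))"
    "iso_class (contract P A) = iso_class (contract Q (f ` A))" if "A \<subseteq> ground P" for A
    unfolding iso_class_eq_iff isomorphic_def upper_simps lower_simps
    using that matroid_iso_delete[OF f(1), of A] matroid_iso_delete[OF f(2), of A]
      matroid_iso_contract[OF f(1), of A] matroid_iso_contract[OF f(2), of A]
    unfolding ground_def lower_ground by blast+
  then show ?thesis unfolding perspective_coproduct_def
    by (subst sum.reindex_bij_betw[OF b, symmetric]) (intro sum.cong, auto)
qed

definition coproduct :: "'k::comm_ring_1 hmp \<Rightarrow> 'k hmp_tensor" where
  "coproduct = lin_map (\<lambda>C. perspective_coproduct (rep_mp_class C))"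

lemma scale_1 [simp]: "scale 1 h = h"
  unfolding scale_def by (intro poly_mapping_eqI) (simp add: Poly_Mapping.map.rep_eq when_def)

lemma lin_map_basis [simp]: "lin_map \<phi> (basis b) = \<phi> b"
  unfolding lin_map_def by simp

lemma lin_form_basis [simp]: "lin_form \<phi> (basis b) = \<phi> b"
  unfolding lin_form_def by simp

lemma coproduct_iso_class: "coproduct (basis (iso_class P)) = perspective_coproduct P"
  unfolding coproduct_def
  by (simp add: perspective_coproduct_cong[OF isomorphic_sym[OF isomorphic_rep]])

lemma hmp_mult_iso_class:
  "hmp_mult (basis (iso_class P)) (basis (iso_class Q)) = basis (iso_class (perspective_sum P Q))"
  unfolding hmp_mult_def by (simp add: class_sum_iso_class)

definition counit :: "'k::comm_ring_1 hmp \<Rightarrow> 'k" where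
  "counit = lin_form (\<lambda>C. if C = iso_class empty_perspective then 1 else 0)"


section \<open>Convolution and the characters\<close>

definition delta_cc :: "'k::comm_ring_1 hmp \<Rightarrow> 'k" where
  "delta_cc = lin_form (\<lambda>C. if C = iso_class U11_U11 then 1 else 0)"

definition delta_ll :: "'k::comm_ring_1 hmp \<Rightarrow> 'k" where
  "delta_ll = lin_form (\<lambda>C. if C = iso_class U01_U01 then 1 else 0)"

definition delta_cl :: "'k::comm_ring_1 hmp \<Rightarrow> 'k" where
  "delta_cl = lin_form (\<lambda>C. if C = iso_class U11_U01 then 1 else 0)"

text \<open>The coefficients are arbitrary scalars.  Indeterminates over a field of characteristic
  0 are covered by taking for \<open>'k\<close> the field of rational functions in them.\<close>

definition delta :: "'k \<Rightarrow> 'k \<Rightarrow> 'k \<Rightarrow> 'k::comm_ring_1 hmp \<Rightarrow> 'k" where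
  "delta a1 a2 a3 h = a1 * delta_cc h + a2 * delta_ll h + a3 * delta_cl h"

text \<open>The composite $m \circ (f \otimes g)$, for linear forms $f$ and $g$.\<close>

definition tensor_form :: "('k hmp \<Rightarrow> 'k) \<Rightarrow> ('k hmp \<Rightarrow> 'k) \<Rightarrow> 'k hmp_tensor \<Rightarrow> 'k::comm_ring_1" where
  "tensor_form f g = lin_form (\<lambda>(C, D). f (basis C) * g (basis D))"

definition conv :: "('k hmp \<Rightarrow> 'k) \<Rightarrow> ('k hmp \<Rightarrow> 'k) \<Rightarrow> 'k hmp \<Rightarrow> 'k::comm_ring_1" where
  "conv f g = tensor_form f g \<circ> coproduct"

primrec conv_power :: "('k hmp \<Rightarrow> 'k) \<Rightarrow> nat \<Rightarrow> 'k hmp \<Rightarrow> 'k::comm_ring_1" where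
  "conv_power f 0 = counit"
| "conv_power f (Suc k) = conv f (conv_power f k)"

text \<open>\<open>Sum_any\<close> adds up the finitely many nonzero terms.  There are only finitely many
  at each \<open>h\<close> whenever the linear form \<open>f\<close> vanishes on the empty perspective, as \<open>delta\<close> does.\<close>

definition conv_exp :: "('k hmp \<Rightarrow> 'k) \<Rightarrow> 'k hmp \<Rightarrow> 'k::field_char_0" where
  "conv_exp f h = Sum_any (\<lambda>k. conv_power f k h / fact k)"


section \<open>Las Vergnas' Tutte polynomial\<close>

text \<open>None of the differences in the exponents is truncated.\<close>

definition tutte :: "'a perspective \<Rightarrow> 'k \<Rightarrow> 'k \<Rightarrow> 'k \<Rightarrow> 'k::comm_ring_1" where
  "tutte P x y z =
     (let E = ground P; r = mrank (upper P); r' = mrank (lower P)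
      in \<Sum>A\<in>Pow E. (x - 1) ^ (r' E - r' A) * (y - 1) ^ (card A - r A) *
           z ^ ((r E - r A) - (r' E - r' A)))"

end

(* Each point of the ground set deletes down to one of the three perspectives on a single element.
   Hence the k-th convolution power of delta is supported on perspectives with k elements, where
   it sums over the k! orderings of the ground set; as ranks telescope under contraction, every
   ordering contributes the same monomial.  So the convolution exponential is that monomial,
   and convolving two of them gives the rank generating function up to normalisation. *)
theory Submission
  imports Defs
begin

section \<open>Linearity, and convolution evaluated on basis elements\<close>

text \<open>Two summands may have different supports, and cancellation may shrink the support of
  their sum; a common finite index set makes them comparable.\<close>

lemma lin_form_superset:
  assumes "finite S" "Poly_Mapping.keys h \<subseteq> S"
  shows "lin_form \<phi> h = (\<Sum>b\<in>S. Poly_Mapping.lookup h b * \<phi> b)"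
  unfolding lin_form_def
  by (rule sum.mono_neutral_left) (use assms in \<open>auto simp: in_keys_iff\<close>)

lemma lin_form_add: "lin_form \<phi> (g + h) = lin_form \<phi> g + lin_form \<phi> h"
proof -
  let ?S = "Poly_Mapping.keys g \<union> Poly_Mapping.keys h"
  have "Poly_Mapping.keys (g + h) \<subseteq> ?S" by (rule Poly_Mapping.keys_add)
  then show ?thesis
    by (simp add: lin_form_superset[of ?S] lookup_add distrib_right sum.distrib)
qed

lemma lin_form_sum: "lin_form \<phi> (sum g S) = (\<Sum>s\<in>S. lin_form \<phi> (g s))"
  by (induction S rule: infinite_finite_induct) (simp_all add: lin_form_add, simp_all add: lin_form_def)

lemma conv_iso_class:
  "conv f g (basis (iso_class P)) = (\<Sum>A\<in>Pow (ground P).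
     f (basis (iso_class (delete P (ground P - A)))) * g (basis (iso_class (contract P A))))"
  unfolding conv_def tensor_form_def
  by (simp add: coproduct_iso_class perspective_coproduct_def lin_form_sum)

section \<open>Rank inequalities and the monomial built from them\<close>

lemma finite_ground [simp]: "finite (ground P)"
  unfolding ground_def by (rule mrank_simps(1))

lemma ground_delete [simp]: "ground (delete P A) = ground P - A"
  by (simp add: ground_def)

lemma ground_contract [simp]: "ground (contract P A) = ground P - A"
  by (simp add: ground_def)

lemma mrank_empty [simp]: "mrank M {} = 0"
  using mrank_simps(3)[of "{}" M] by simp

lemma mrank_diff_lower_le_upper:
  "A \<subseteq> B \<Longrightarrow> mrank (lower P) B - mrank (lower P) A \<le> mrank (upper P) B - mrank (upper P) A"
  by (rule is_perspectiveD[OF is_perspective_upper_lower])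

lemma mrank_lower_le_upper: "mrank (lower P) A \<le> mrank (upper P) A"
  using mrank_diff_lower_le_upper[of "{}" A P] by simp

lemma mrank_upper_le_card: "A \<subseteq> ground P \<Longrightarrow> mrank (upper P) A \<le> card A"
  unfolding ground_def by (rule mrank_simps(3))

text \<open>This is monotonicity of the nullity. It follows from submodularity for \<open>A\<close>
  and its complement, whose intersection has rank zero.\<close>

lemma mrank_upper_diff_le_card:
  assumes "A \<subseteq> ground P"
  shows "mrank (upper P) (ground P) - mrank (upper P) A \<le> card (ground P) - card A"
proof -
  have "mrank (upper P) (ground P) \<le> mrank (upper P) A + mrank (upper P) (ground P - A)"
    using mrank_simps(5)[of "upper P" A "ground P - A"] assms by (simp add: Un_absorb1)
  moreover have "mrank (upper P) (ground P - A) \<le> card (ground P) - card A"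
    using mrank_upper_le_card[of "ground P - A" P] assms
    by (simp add: card_Diff_subset finite_subset)
  ultimately show ?thesis by linarith
qed

text \<open>Each of the three exponents splits into a share of the restriction to \<open>A\<close>
  and a share of the contraction by \<open>A\<close>. Over the integers these are identities; the
  inequalities in the proof ensure that no natural subtraction truncates.\<close>

lemma rank_telescope:
  assumes A: "A \<subseteq> ground P"
  defines "E \<equiv> ground P" and "r \<equiv> mrank (upper P)" and "r' \<equiv> mrank (lower P)"
  shows "r' E = r' A + (r' E - r' A)"
    and "card E - r E = card A - r A + (card E - card A - (r E - r A))"
    and "r E - r' E = r A - r' A + (r E - r A - (r' E - r' A))"
proof -
  have s: "r' A \<le> r' E" and r: "r A \<le> r E"
    unfolding E_def r_def r'_def by (rule mrank_simps(4)[OF A])+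
  show "r' E = r' A + (r' E - r' A)"
    using s by simp
  have "r A \<le> card A" "card A \<le> card E" "r E - r A \<le> card E - card A"
    unfolding E_def r_def
    by (rule mrank_upper_le_card[OF A], rule card_mono[OF finite_ground A],
        rule mrank_upper_diff_le_card[OF A])
  then show "card E - r E = card A - r A + (card E - card A - (r E - r A))"
    using r by linarith
  have "r' A \<le> r A" "r' E - r' A \<le> r E - r A"
    unfolding E_def r_def r'_def
    by (rule mrank_lower_le_upper, rule mrank_diff_lower_le_upper[OF A])
  then show "r E - r' E = r A - r' A + (r E - r A - (r' E - r' A))"
    using r s by linarith
qed

text \<open>This turns out to be the value of the convolution exponential of
  \<open>delta a1 a2 a3\<close>. With \<open>x1\<close>, \<open>y2\<close>, \<open>x3\<close> as
  scalars it is also the prefactor in the final formula.\<close>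

definition monomial :: "'k::comm_ring_1 \<Rightarrow> 'k \<Rightarrow> 'k \<Rightarrow> 'e perspective \<Rightarrow> 'k" where
  "monomial a1 a2 a3 P =
     a1 ^ mrank (lower P) (ground P) * a2 ^ (card (ground P) - mrank (upper P) (ground P)) *
     a3 ^ (mrank (upper P) (ground P) - mrank (lower P) (ground P))"

lemma monomial_delete:
  assumes "A \<subseteq> ground P"
  shows "monomial a1 a2 a3 (delete P (ground P - A)) =
    a1 ^ mrank (lower P) A * a2 ^ (card A - mrank (upper P) A) *
    a3 ^ (mrank (upper P) A - mrank (lower P) A)"
proof -
  have "ground P - (ground P - A) = A" "A - (ground P - A) = A" using assms by auto
  then show ?thesis by (simp add: monomial_def)
qed

lemma monomial_contract:
  assumes "A \<subseteq> ground P"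
  shows "monomial a1 a2 a3 (contract P A) =
    a1 ^ (mrank (lower P) (ground P) - mrank (lower P) A) *
    a2 ^ (card (ground P) - card A - (mrank (upper P) (ground P) - mrank (upper P) A)) *
    a3 ^ (mrank (upper P) (ground P) - mrank (upper P) A
          - (mrank (lower P) (ground P) - mrank (lower P) A))"
proof -
  have "ground P - A \<union> A = ground P" using assms by auto
  then show ?thesis
    using assms by (simp add: monomial_def card_Diff_subset finite_subset)
qed

text \<open>The exponents add up by \<open>rank_telescope\<close>, so the product does not depend on
  \<open>A\<close>. This is why all orderings of the ground set contribute equally to a convolution
  power.\<close>

lemma monomial_delete_mult_contract:
  assumes A: "A \<subseteq> ground P"
  shows "monomial a1 a2 a3 (delete P (ground P - A)) * monomial a1 a2 a3 (contract P A)
    = monomial a1 a2 a3 P"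
proof -
  let ?E = "ground P" and ?r = "mrank (upper P)" and ?s = "mrank (lower P)"
  have "monomial a1 a2 a3 P = a1 ^ (?s A + (?s ?E - ?s A)) *
      a2 ^ (card A - ?r A + (card ?E - card A - (?r ?E - ?r A))) *
      a3 ^ (?r A - ?s A + (?r ?E - ?r A - (?s ?E - ?s A)))"
    by (simp only: monomial_def rank_telescope[OF A, symmetric])
  then show ?thesis
    by (simp only: monomial_delete[OF A] monomial_contract[OF A] power_add mult_ac)
qed

section \<open>Isomorphism of perspectives on at most one element\<close>

lemma isomorphic_card_ground: "isomorphic P Q \<Longrightarrow> card (ground P) = card (ground Q)"
  unfolding isomorphic_def ground_def by (metis matroid_isoD(1) bij_betw_same_card)

lemma isomorphic_mrank_ground:
  assumes "isomorphic P Q"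
  shows "mrank (upper P) (ground P) = mrank (upper Q) (ground Q)"
    "mrank (lower P) (ground P) = mrank (lower Q) (ground Q)"
proof -
  obtain f where f: "matroid_iso f (upper P) (upper Q)" "matroid_iso f (lower P) (lower Q)"
    using assms unfolding isomorphic_def by blast
  have "f ` ground P = ground Q"
    using matroid_isoD(1)[OF f(1)] by (simp add: ground_def bij_betw_def)
  then show "mrank (upper P) (ground P) = mrank (upper Q) (ground Q)"
    "mrank (lower P) (ground P) = mrank (lower Q) (ground Q)"
    using matroid_isoD(2)[OF f(1), of "ground P"] matroid_isoD(2)[OF f(2), of "ground P"]
    by (simp_all add: ground_def lower_ground)
qed

text \<open>The only subsets to compare are the empty set and the whole ground set, so any bijection
  preserves all ranks once the total ranks agree.\<close>

lemma isomorphic_if_card_le_1: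
  assumes "card (ground P) = card (ground Q)" "card (ground P) \<le> 1"
    and "mrank (upper P) (ground P) = mrank (upper Q) (ground Q)"
    and "mrank (lower P) (ground P) = mrank (lower Q) (ground Q)"
  shows "isomorphic P Q"
proof -
  obtain f where f: "bij_betw f (ground P) (ground Q)"
    using finite_same_card_bij[OF finite_ground finite_ground assms(1)] by blast
  have X: "X = {} \<or> X = ground P" if "X \<subseteq> ground P" for X
  proof (cases "X = {}")
    case False
    then have "card X \<noteq> 0" using finite_subset[OF that finite_ground] by simp
    then have "card X = card (ground P)"
      using card_mono[OF finite_ground that] assms(2) by linarith
    then have "X = ground P" by (rule card_subset_eq[OF finite_ground that])
    then show ?thesis ..
  qed simp
  have rank: "mrank (upper Q) (f ` X) = mrank (upper P) X" "mrank (lower Q) (f ` X) = mrank (lower P) X"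
    if "X \<subseteq> ground P" for X
    using X[OF that] by (elim disjE; simp add: assms(3,4) bij_betw_imp_surj_on[OF f])+
  have "matroid_iso f (upper P) (upper Q)" "matroid_iso f (lower P) (lower Q)"
    by (rule matroid_isoI; use f rank in \<open>simp only: lower_ground ground_def\<close>)+
  then show ?thesis unfolding isomorphic_def by blast
qed

text \<open>This reduces the comparisons of classes in \<open>counit\<close> and
  \<open>delta\<close> to arithmetic. Bounding \<open>Q\<close> suffices, as each direction has or
  assumes equal cardinalities.\<close>

lemma isomorphic_iff_if_card_le_1:
  assumes "card (ground Q) \<le> 1"
  shows "isomorphic P Q \<longleftrightarrow> card (ground P) = card (ground Q)
    \<and> mrank (upper P) (ground P) = mrank (upper Q) (ground Q)
    \<and> mrank (lower P) (ground P) = mrank (lower Q) (ground Q)"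
proof (intro iffI conjI)
  show "isomorphic P Q" if "card (ground P) = card (ground Q)
    \<and> mrank (upper P) (ground P) = mrank (upper Q) (ground Q)
    \<and> mrank (lower P) (ground P) = mrank (lower Q) (ground Q)"
    using that assms by (intro isomorphic_if_card_le_1) auto
qed (fact isomorphic_card_ground isomorphic_mrank_ground)+

section \<open>The counit, \<open>delta\<close>, and its convolution powers and exponential\<close>

lemma small_perspectives_simps [simp]:
  "upper U11_U11 = uniform 1 1" "lower U11_U11 = uniform 1 1"
  "upper U01_U01 = uniform 0 1" "lower U01_U01 = uniform 0 1"
  "upper U11_U01 = uniform 1 1" "lower U11_U01 = uniform 0 1"
  "upper empty_perspective = uniform 0 0" "lower empty_perspective = uniform 0 0"
  by (simp_all add: upper.rep_eq lower.rep_eq U11_U11.rep_eq U01_U01.rep_eq U11_U01.rep_eq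
      empty_perspective.rep_eq)

lemma counit_iso_class:
  "counit (basis (iso_class P)) = (if ground P = {} then 1 else 0)"
  by (auto simp: counit_def iso_class_eq_iff isomorphic_iff_if_card_le_1 ground_def mrank_simps(1))

lemma delta_iso_class:
  "delta a1 a2 a3 (basis (iso_class P)) =
    (if card (ground P) = 1 then monomial a1 a2 a3 P else 0)"
proof -
  have "mrank (lower P) (ground P) \<le> mrank (upper P) (ground P)"
    "mrank (upper P) (ground P) \<le> card (ground P)"
    by (rule mrank_lower_le_upper, rule mrank_upper_le_card[OF order_refl])
  \<comment> \<open>On one element the ranks satisfy r' \<le> r \<le> 1. The perspective inequality
    excludes r' = 1 with r = 0, which leaves the three supports of \<open>delta_cc\<close>,
    \<open>delta_ll\<close> and \<open>delta_cl\<close>.\<close>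
  then consider "card (ground P) \<noteq> 1"
    | "card (ground P) = 1" "mrank (lower P) (ground P) = 1" "mrank (upper P) (ground P) = 1"
    | "card (ground P) = 1" "mrank (lower P) (ground P) = 0" "mrank (upper P) (ground P) = 0"
    | "card (ground P) = 1" "mrank (lower P) (ground P) = 0" "mrank (upper P) (ground P) = 1"
    by linarith
  moreover have "ground U11_U11 = {..<1}" "ground U01_U01 = {..<1}" "ground U11_U01 = {..<1}"
    by (simp_all add: ground_def)
  ultimately show ?thesis
    by cases (simp_all add: delta_def delta_cc_def delta_ll_def delta_cl_def iso_class_eq_iff
        isomorphic_iff_if_card_le_1 monomial_def)
qed

text \<open>Induction on \<open>k\<close> peels off the first element of an ordering.
  \<open>P\<close> must vary because the hypothesis is applied to its contraction by that
  element.\<close>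

lemma conv_power_delta:
  "conv_power (delta a1 a2 a3) k (basis (iso_class P)) =
    (if card (ground P) = k then fact k * monomial a1 a2 a3 P else 0)"
proof (induction k arbitrary: P)
  case 0
  show ?case by (auto simp: counit_iso_class monomial_def)
next
  case (Suc k)
  let ?E = "ground P" and ?m = "monomial a1 a2 a3"
  let ?S = "(\<lambda>e. {e}) ` ?E"
  let ?g = "\<lambda>A. delta a1 a2 a3 (basis (iso_class (delete P (?E - A)))) *
      conv_power (delta a1 a2 a3) k (basis (iso_class (contract P A)))"
  have g: "?g A = (if card A = 1 then (if card ?E = Suc k then fact k * ?m P else 0) else 0)"
    if A: "A \<subseteq> ?E" for A
  proof -
    have "?E - (?E - A) = A" using A by auto
    moreover have "card (?E - A) = k \<longleftrightarrow> card ?E = Suc k" if "card A = 1"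
      using that A card_mono[OF finite_ground A] by (auto simp: card_Diff_subset finite_subset)
    ultimately show ?thesis
      using monomial_delete_mult_contract[OF A, of a1 a2 a3]
      by (auto simp: delta_iso_class Suc.IH mult.left_commute)
  qed
  have "conv_power (delta a1 a2 a3) (Suc k) (basis (iso_class P)) = sum ?g (Pow ?E)"
    by (simp add: conv_iso_class)
  \<comment> \<open>The factor \<open>delta\<close> vanishes unless the restriction has one element,
    so only singletons survive.\<close>
  also have "\<dots> = sum ?g ?S"
    by (rule sum.mono_neutral_right) (auto simp: g card_1_singleton_iff)
  also have "\<dots> = (\<Sum>e\<in>?E. ?g {e})"
    by (subst sum.reindex) auto
  also have "\<dots> = (\<Sum>e\<in>?E. if card ?E = Suc k then fact k * ?m P else 0)"
    by (rule sum.cong[OF refl], subst g) auto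
  \<comment> \<open>The \<open>Suc k\<close> equal terms raise \<open>fact k\<close> to
    \<open>fact (Suc k)\<close>.\<close>
  also have "\<dots> = (if card ?E = Suc k then fact (Suc k) * ?m P else 0)"
    by (simp add: algebra_simps)
  finally show ?case .
qed

text \<open>Only the power with \<open>k = card (ground P)\<close> survives, and its factorial
  cancels the denominator of the exponential series.\<close>

lemma conv_exp_delta:
  "conv_exp (delta a1 a2 a3) (basis (iso_class P)) = monomial a1 a2 a3 P"
proof -
  have "conv_power (delta a1 a2 a3) k (basis (iso_class P)) / fact k =
      (if k = card (ground P) then monomial a1 a2 a3 P else 0)" for k
    by (simp add: conv_power_delta)
  then show ?thesis unfolding conv_exp_def
    by (simp add: Sum_any.expand_superset[of "{card (ground P)}"])
qed

theorem theorem3p13: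
  fixes x1 x2 x3 y1 y2 y3 :: "'k::field_char_0" and P :: "'e perspective"
  defines "\<alpha> \<equiv> conv (conv_exp (delta x1 x2 x3)) (conv_exp (delta y1 y2 y3))"
    and "E \<equiv> ground P" and "r \<equiv> mrank (upper P)" and "r' \<equiv> mrank (lower P)"
  assumes "x1 \<noteq> 0" and "y2 \<noteq> 0" and "x3 \<noteq> 0"
  shows "\<alpha> (basis (iso_class P)) =
    x1 ^ r' E * y2 ^ (card E - r E) * x3 ^ (r E - r' E) *
      tutte P (y1 / x1 + 1) (x2 / y2 + 1) (y3 / x3)"
proof -
  \<comment> \<open>The prefactor carries the full exponent of \<open>a\<close>; the share
    \<open>n\<close> of it clears the denominator of the Tutte argument.\<close>
  have rescale: "a ^ (m + n) * (b / a) ^ n = a ^ m * b ^ n" if "a \<noteq> 0" for a b :: 'k and m n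
    using that by (simp add: power_add power_divide)
  have summand: "monomial x1 x2 x3 (delete P (E - A)) * monomial y1 y2 y3 (contract P A) =
      x1 ^ r' E * y2 ^ (card E - r E) * x3 ^ (r E - r' E) *
      ((y1 / x1) ^ (r' E - r' A) * (x2 / y2) ^ (card A - r A) *
       (y3 / x3) ^ ((r E - r A) - (r' E - r' A)))" if "A \<subseteq> E" for A
  proof -
    have A: "A \<subseteq> ground P" using that by (simp add: E_def)
    \<comment> \<open>The exponents \<open>i\<close>, \<open>l\<close>, \<open>m\<close> come from
      the restriction to \<open>A\<close> and carry the x-scalars; \<open>j\<close>,
      \<open>k\<close>, \<open>n\<close> come from the contraction and carry the y-scalars.
      Normalising by \<open>y2\<close> instead of \<open>x2\<close> reflects that the Tutte exponent
      \<open>l\<close> is the nullity of the restriction, whereas the other two Tutte exponents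
      \<open>j\<close> and \<open>n\<close> belong to the contraction.\<close>
    define i j k l m n where "i = r' A" and "j = r' E - r' A"
      and "k = card E - card A - (r E - r A)" and "l = card A - r A"
      and "m = r A - r' A" and "n = (r E - r A) - (r' E - r' A)"
    have "r' E = i + j" "card E - r E = k + l" "r E - r' E = m + n"
      using rank_telescope[OF A]
      by (simp_all only: i_def j_def k_def l_def m_def n_def E_def r_def r'_def add.commute)
    then have "x1 ^ r' E * y2 ^ (card E - r E) * x3 ^ (r E - r' E) *
        ((y1 / x1) ^ j * (x2 / y2) ^ l * (y3 / x3) ^ n) =
      (x1 ^ (i + j) * (y1 / x1) ^ j) * (y2 ^ (k + l) * (x2 / y2) ^ l) *
        (x3 ^ (m + n) * (y3 / x3) ^ n)"
      by (simp only: mult_ac)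
    also have "\<dots> = (x1 ^ i * x2 ^ l * x3 ^ m) * (y1 ^ j * y2 ^ k * y3 ^ n)"
      by (simp only: rescale[OF assms(5)] rescale[OF assms(6)] rescale[OF assms(7)])
        (simp only: mult_ac)
    also have "\<dots> = monomial x1 x2 x3 (delete P (E - A)) * monomial y1 y2 y3 (contract P A)"
      using A by (simp add: E_def r_def r'_def i_def j_def k_def l_def m_def n_def
          monomial_delete monomial_contract)
    finally show ?thesis by (simp add: j_def l_def n_def)
  qed
  have "\<alpha> (basis (iso_class P)) =
      (\<Sum>A\<in>Pow E. monomial x1 x2 x3 (delete P (E - A)) * monomial y1 y2 y3 (contract P A))"
    by (simp add: \<alpha>_def E_def conv_iso_class conv_exp_delta)
  also have "\<dots> = x1 ^ r' E * y2 ^ (card E - r E) * x3 ^ (r E - r' E) *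
      tutte P (y1 / x1 + 1) (x2 / y2 + 1) (y3 / x3)"
    \<comment> \<open>The shifts by 1 in the first two arguments cancel those built into
      \<open>tutte\<close>.\<close>
    by (simp add: summand tutte_def Let_def sum_distrib_left E_def[symmetric]
        r_def[symmetric] r'_def[symmetric])
  finally show ?thesis .
qed

end
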